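(* Let $A$ be an $(N-1)\times N$ tw-matrix. Then the vector of maximal minors of $A$ (whose $j$th entry is the maximal minor obtained by deleting column $j$) is in the tw-kernel of $A$. Furthermore, this vector is the unique vector in the tw-kernel of $A$ up to tropical scaling if and only if every maximal minor of $A$ is tw-nonsingular.
   Context: A $K\times N$ tw-matrix (tropical weighted matrix) $A$ is an $M\times N$ matrix with entries in $\mathbb{T}$ (as a set, $\mathbb{T}=\mathbb{R}$), together with integers $m_1,\dots,m_M\ge 1$ (weights of the rows) with $\sum_{i=1}^M m_i=K$. A vector $\mathbf{x}=(x_1,\dots,x_N)\in\mathbb{R}^N$ is in the tw-kernel of $A$ if for each row $i$ the minimum $\min_j\{x_j+A_{ij}\}$ is achieved by at least $m_i+1$ indices $j$. Tropical scaling of a vector means adding the same real constant to all its entries. The tw-permanent of a $K\times K$ tw-matrix $A$ is $\min_{\mathcal{I}}\{\sum_i\sum_{j\in I_i}A_{ij}\}$, the minimum over all partitions $\mathcal{I}=(I_1,\dots,I_M)$ of the set of columns into labelled subsets with $|I_i|=m_i$. The tw-matrix (or its tw-permanent) is tw-singular if this minimum is achieved by more than one $\mathcal{I}$, and tw-nonsingular otherwise. A maximal minor of an $(N-1)\times N$ tw-matrix $A$ is the tw-permanent of the $(N-1)\times(N-1)$ tw-matrix formed by deleting a column of $A$ (keeping the row weights). *)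

theory Defs
  imports Complex_Main "HOL-Library.FuncSet" "HOL-Library.Disjoint_Sets"
begin

text \<open>
  A tw-matrix is given by a finite set \<open>R\<close> of row indices, a finite set \<open>C\<close> of column
  indices, row weights \<open>m\<close> and entries \<open>A\<close>; only the values of \<open>m\<close> on \<open>R\<close> and of \<open>A\<close> on
  \<open>R \<times> C\<close> matter. Column sets are arbitrary, rather than initial segments of the natural
  numbers, so that a column can be deleted without renumbering the others. The
  entries range over the whole of \<open>\<real>\<close>, so \<open>A\<close> is unconstrained.
\<close>

definition tw_matrix :: "nat \<Rightarrow> nat \<Rightarrow> 'r set \<Rightarrow> 'c set \<Rightarrow> ('r \<Rightarrow> nat) \<Rightarrow> ('r \<Rightarrow> 'c \<Rightarrow> real) \<Rightarrow> bool"
  where "tw_matrix K N R C m A \<longleftrightarrow>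
    finite R \<and> finite C \<and> card C = N \<and> (\<forall>i\<in>R. m i \<ge> 1) \<and> (\<Sum>i\<in>R. m i) = K"

text \<open>Vectors indexed by \<open>C\<close> are functions of which only the values on \<open>C\<close> matter.\<close>

definition tw_kernel :: "'r set \<Rightarrow> 'c set \<Rightarrow> ('r \<Rightarrow> nat) \<Rightarrow> ('r \<Rightarrow> 'c \<Rightarrow> real) \<Rightarrow> ('c \<Rightarrow> real) set"
  where "tw_kernel R C m A =
    {x. \<forall>i\<in>R. card {j\<in>C. x j + A i j = Min ((\<lambda>k. x k + A i k) ` C)} \<ge> m i + 1}"

definition trop_scaling_of :: "'c set \<Rightarrow> ('c \<Rightarrow> real) \<Rightarrow> ('c \<Rightarrow> real) \<Rightarrow> bool"
  where "trop_scaling_of C x y \<longleftrightarrow> (\<exists>c::real. \<forall>j\<in>C. x j = y j + c)"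

text \<open>
  The families are required to be extensional (\<open>\<rightarrow>\<^sub>E\<close>), so that two of them are equal as
  soon as they agree on \<open>R\<close>; otherwise the partitions would not be counted correctly.
\<close>

definition tw_partitions :: "'r set \<Rightarrow> 'c set \<Rightarrow> ('r \<Rightarrow> nat) \<Rightarrow> ('r \<Rightarrow> 'c set) set"
  where "tw_partitions R C m =
    {I \<in> R \<rightarrow>\<^sub>E Pow C. disjoint_family_on I R \<and> (\<Union>i\<in>R. I i) = C \<and> (\<forall>i\<in>R. card (I i) = m i)}"

definition tw_weight :: "'r set \<Rightarrow> ('r \<Rightarrow> 'c \<Rightarrow> real) \<Rightarrow> ('r \<Rightarrow> 'c set) \<Rightarrow> real"
  where "tw_weight R A I = (\<Sum>i\<in>R. \<Sum>j\<in>I i. A i j)"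

text \<open>Meaningful only for square tw-matrices: otherwise there are no partitions.\<close>

definition tw_permanent :: "'r set \<Rightarrow> 'c set \<Rightarrow> ('r \<Rightarrow> nat) \<Rightarrow> ('r \<Rightarrow> 'c \<Rightarrow> real) \<Rightarrow> real"
  where "tw_permanent R C m A = Min (tw_weight R A ` tw_partitions R C m)"

definition tw_singular :: "'r set \<Rightarrow> 'c set \<Rightarrow> ('r \<Rightarrow> nat) \<Rightarrow> ('r \<Rightarrow> 'c \<Rightarrow> real) \<Rightarrow> bool"
  where "tw_singular R C m A \<longleftrightarrow>
    (\<exists>I\<in>tw_partitions R C m. \<exists>J\<in>tw_partitions R C m. I \<noteq> J \<and>
      tw_weight R A I = tw_permanent R C m A \<and> tw_weight R A J = tw_permanent R C m A)"

abbreviation tw_nonsingular :: "'r set \<Rightarrow> 'c set \<Rightarrow> ('r \<Rightarrow> nat) \<Rightarrow> ('r \<Rightarrow> 'c \<Rightarrow> real) \<Rightarrow> bool"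
  where "tw_nonsingular R C m A \<equiv> \<not> tw_singular R C m A"

definition maximal_minor :: "'r set \<Rightarrow> 'c set \<Rightarrow> ('r \<Rightarrow> nat) \<Rightarrow> ('r \<Rightarrow> 'c \<Rightarrow> real) \<Rightarrow> 'c \<Rightarrow> real"
  where "maximal_minor R C m A j = tw_permanent R (C - {j}) m A"

end

theory Submission
  imports Defs
begin

text \<open>
  A partition is treated as an assignment \<open>f\<close> of columns to rows in which row \<open>i\<close> receives
  \<open>m i\<close> columns. Let \<open>p\<close> be the vector of maximal minors, and call column \<open>k\<close> tight for
  row \<open>i\<close> if it attains the minimum of \<open>p k + A i k\<close> over \<open>k\<close>.

  To see that \<open>p\<close> is in the kernel, raise the weight of one row \<open>i\<close> by one, so that the
  whole matrix becomes square. An assignment of all columns that puts \<open>k\<close> into row \<open>i\<close> is the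
  same as an assignment for the minor that omits \<open>k\<close>, followed by \<open>k\<close> being added to row
  \<open>i\<close>; hence the least cost with \<open>k\<close> in row \<open>i\<close> is \<open>p k + A i k\<close>. All the \<open>m i + 1\<close>
  columns that an optimal assignment puts into row \<open>i\<close> are therefore tight for \<open>i\<close>
  (\<open>card_tight\<close>).

  For uniqueness, the optimal assignments of the minors must be recognised from the tight
  columns alone. Every column of an optimal assignment is tight for its row
  (\<open>optimal_assignment_tight\<close>, an exchange argument), and all assignments of this kind for
  a given minor have the same cost (\<open>cost_of_tight_assignment\<close>). So a minor is singular
  if and only if it has two assignments with all columns tight.

  Call a set \<open>V\<close> of columns stable if every row with a tight column in \<open>V\<close> has at least
  \<open>m i + 1\<close> of them. Both sides of the equivalence amount to the statement that
  no nonempty proper stable set exists: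

  \<^item> If \<open>x\<close> is in the kernel, the columns that minimise \<open>x - p\<close> form a stable set,
    which is proper unless \<open>x\<close> is a scaling of \<open>p\<close>. Conversely, raising \<open>p\<close> slightly
    outside a stable set leaves it in the kernel.

  \<^item> Given a stable set \<open>V\<close>, take an optimal assignment for the minor of a column outside
    \<open>V\<close>. Every row with a tight column in \<open>V\<close> has one in \<open>V\<close> that is
    assigned elsewhere, so the rows can trade columns around a cycle, and the minor is
    singular. Conversely, from two optimal assignments of a minor a stable set
    grows out of the columns on which they differ.
\<close>

section \<open>Partitions as assignments of columns to rows\<close>

definition assigns :: "'r set \<Rightarrow> 'c set \<Rightarrow> ('r \<Rightarrow> nat) \<Rightarrow> ('c \<Rightarrow> 'r) \<Rightarrow> bool"
  where "assigns R D m f \<longleftrightarrow> f ` D \<subseteq> R \<and> (\<forall>i\<in>R. card {c\<in>D. f c = i} = m i)"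

definition cost :: "('r \<Rightarrow> 'c \<Rightarrow> real) \<Rightarrow> 'c set \<Rightarrow> ('c \<Rightarrow> 'r) \<Rightarrow> real"
  where "cost A D f = (\<Sum>c\<in>D. A (f c) c)"

definition fibres :: "'r set \<Rightarrow> 'c set \<Rightarrow> ('c \<Rightarrow> 'r) \<Rightarrow> 'r \<Rightarrow> 'c set"
  where "fibres R D f = (\<lambda>i\<in>R. {c\<in>D. f c = i})"

lemma fibres_in_partitions:
  assumes "assigns R D m f"
  shows "fibres R D f \<in> tw_partitions R D m"
  using assms unfolding assigns_def fibres_def tw_partitions_def disjoint_family_on_def
  by (auto simp: PiE_iff)

lemma weight_fibres:
  assumes "finite R" "finite D" "f ` D \<subseteq> R"
  shows "tw_weight R A (fibres R D f) = cost A D f"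
proof -
  have "tw_weight R A (fibres R D f) = (\<Sum>i\<in>R. \<Sum>j\<in>{c\<in>D. f c = i}. A (f j) j)"
    unfolding tw_weight_def fibres_def by (intro sum.cong) auto
  also have "\<dots> = cost A D f"
    unfolding cost_def using assms by (intro sum.group) auto
  finally show ?thesis .
qed

lemma partition_is_fibres:
  assumes "I \<in> tw_partitions R D m"
  obtains f where "assigns R D m f" "fibres R D f = I"
proof -
  have I: "I \<in> R \<rightarrow>\<^sub>E Pow D" "disjoint_family_on I R" "(\<Union>i\<in>R. I i) = D"
    "\<forall>i\<in>R. card (I i) = m i"
    using assms unfolding tw_partitions_def by auto
  have "\<forall>c\<in>D. \<exists>i\<in>R. c \<in> I i" using I(3) by blast
  then obtain f where f: "\<And>c. c \<in> D \<Longrightarrow> f c \<in> R \<and> c \<in> I (f c)" by metis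
  have fib: "{c\<in>D. f c = i} = I i" if "i \<in> R" for i
    using that f I(2,3) unfolding disjoint_family_on_def by blast
  show ?thesis
  proof
    show "assigns R D m f" unfolding assigns_def using f fib I(4) by auto
    show "fibres R D f = I"
      using I(1) fib unfolding fibres_def by (auto simp: PiE_iff extensional_def restrict_def fun_eq_iff)
  qed
qed

lemma fibres_inj:
  assumes "f ` D \<subseteq> R" and eq: "fibres R D f = fibres R D g"
  shows "\<forall>c\<in>D. f c = g c"
proof
  fix c assume c: "c \<in> D"
  have "c \<in> fibres R D f (f c)" using assms(1) c by (auto simp: fibres_def)
  then have "c \<in> fibres R D g (f c)" by (simp add: eq)
  then show "f c = g c" using assms(1) c by (auto simp: fibres_def)
qed

lemma finite_partitions:
  assumes "finite R" "finite D"
  shows "finite (tw_partitions R D m)"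
  by (rule finite_subset[of _ "R \<rightarrow>\<^sub>E Pow D"])
     (use assms in \<open>auto simp: tw_partitions_def intro!: finite_PiE\<close>)

lemma permanent_le_cost:
  assumes "finite R" "finite D" "assigns R D m f"
  shows "tw_permanent R D m A \<le> cost A D f"
proof -
  have "tw_weight R A (fibres R D f) \<in> tw_weight R A ` tw_partitions R D m"
    using fibres_in_partitions[OF assms(3)] by simp
  then show ?thesis
    unfolding tw_permanent_def
    using weight_fibres[of R D f A] assms finite_partitions[of R D m]
    by (simp add: assigns_def)
qed

text \<open>
  Induction on the columns: the new column goes to any row of positive weight, and the
  remaining columns are assigned with the weight of that row lowered by one.
\<close>

lemma assigns_exists:
  assumes "finite R" "finite D" "card D = sum m R"
  shows "\<exists>f. assigns R D m f"
  using assms(2,3)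
proof (induction D arbitrary: m rule: finite_induct)
  case empty
  then show ?case using assms(1) by (auto simp: assigns_def)
next
  case (insert c D)
  then have "sum m R \<noteq> 0" by auto
  then obtain i where i: "i \<in> R" "m i \<noteq> 0" by (meson sum.neutral)
  have "sum m R = m i + sum m (R - {i})" using assms(1) i(1) by (simp add: sum.remove)
  moreover have "sum (m(i := m i - 1)) R = m i - 1 + sum m (R - {i})"
    using assms(1) i(1) by (simp add: sum.remove)
  ultimately have "card D = sum (m(i := m i - 1)) R" using insert i by simp
  from insert.IH[OF this] obtain f where f: "assigns R D (m(i := m i - 1)) f" by blast
  have fib: "{x \<in> insert c D. (f(c := i)) x = i'} =
    (if i' = i then insert c {x\<in>D. f x = i'} else {x\<in>D. f x = i'})" for i'
    using insert.hyps(2) by auto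
  have "assigns R (insert c D) m (f(c := i))"
    unfolding assigns_def
  proof (intro conjI ballI)
    show "f(c := i) ` insert c D \<subseteq> R" using f i(1) unfolding assigns_def by auto
    fix i' assume "i' \<in> R"
    then have "card {x\<in>D. f x = i'} = (m(i := m i - 1)) i'" using f unfolding assigns_def by simp
    then show "card {x \<in> insert c D. (f(c := i)) x = i'} = m i'"
      using fib i(2) insert.hyps by auto
  qed
  then show ?case by blast
qed

lemma optimal_assignment:
  assumes "finite R" "finite D" "card D = sum m R"
  obtains f where "assigns R D m f" "cost A D f = tw_permanent R D m A"
proof -
  obtain f0 where "assigns R D m f0" using assigns_exists[OF assms] by blast
  then have "tw_weight R A ` tw_partitions R D m \<noteq> {}"
    using fibres_in_partitions by blast
  then have "tw_permanent R D m A \<in> tw_weight R A ` tw_partitions R D m"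
    unfolding tw_permanent_def
    using finite_partitions[OF assms(1,2)] by (intro Min_in) auto
  then obtain I where I: "I \<in> tw_partitions R D m" "tw_permanent R D m A = tw_weight R A I" by auto
  obtain f where f: "assigns R D m f" "fibres R D f = I" using partition_is_fibres[OF I(1)] .
  show ?thesis
    by (rule that[OF f(1)]) (use f I weight_fibres[of R D f A] assms in \<open>auto simp: assigns_def\<close>)
qed

lemma singular_iff_assignments:
  assumes "finite R" "finite D"
  shows "tw_singular R D m A \<longleftrightarrow>
    (\<exists>f g. assigns R D m f \<and> assigns R D m g \<and> (\<exists>c\<in>D. f c \<noteq> g c) \<and>
      cost A D f = tw_permanent R D m A \<and> cost A D g = tw_permanent R D m A)"
    (is "_ \<longleftrightarrow> ?two")
proof
  assume "tw_singular R D m A"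
  then obtain I J where IJ: "I \<in> tw_partitions R D m" "J \<in> tw_partitions R D m" "I \<noteq> J"
      "tw_weight R A I = tw_permanent R D m A" "tw_weight R A J = tw_permanent R D m A"
    unfolding tw_singular_def by blast
  obtain f where f: "assigns R D m f" "fibres R D f = I" using partition_is_fibres[OF IJ(1)] .
  obtain g where g: "assigns R D m g" "fibres R D g = J" using partition_is_fibres[OF IJ(2)] .
  have "\<exists>c\<in>D. f c \<noteq> g c"
  proof (rule ccontr)
    assume "\<not> ?thesis"
    then have "{c\<in>D. f c = i} = {c\<in>D. g c = i}" for i by auto
    then have "fibres R D f = fibres R D g" unfolding fibres_def by simp
    then show False using f g IJ(3) by simp
  qed
  moreover have "cost A D f = tw_weight R A I" "cost A D g = tw_weight R A J"
    using f g weight_fibres[OF assms, of f A] weight_fibres[OF assms, of g A]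
    unfolding assigns_def by auto
  ultimately show ?two using f g IJ(4,5) by auto
next
  assume ?two
  then obtain f g where fg: "assigns R D m f" "assigns R D m g" "\<exists>c\<in>D. f c \<noteq> g c"
      "cost A D f = tw_permanent R D m A" "cost A D g = tw_permanent R D m A" by blast
  have "fibres R D f \<noteq> fibres R D g"
    using fibres_inj[of f D R g] fg unfolding assigns_def by blast
  moreover have "tw_weight R A (fibres R D f) = cost A D f" "tw_weight R A (fibres R D g) = cost A D g"
    using fg(1,2) weight_fibres[OF assms, of f A] weight_fibres[OF assms, of g A]
    unfolding assigns_def by auto
  ultimately show "tw_singular R D m A"
    unfolding tw_singular_def using fg(4,5)
    by (intro bexI[OF _ fibres_in_partitions[OF fg(1)]] bexI[OF _ fibres_in_partitions[OF fg(2)]]) simp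
qed

text \<open>
  This lemma and the next identify the assignments of \<open>C\<close> that put \<open>k\<close> into row \<open>i\<close>,
  for weights raised by one at \<open>i\<close>, with the assignments that omit \<open>k\<close>.
\<close>

lemma assigns_extend:
  assumes "finite C" "k \<in> C" "i \<in> R" "assigns R (C - {k}) m g"
  shows "assigns R C (m(i := Suc (m i))) (g(k := i))"
    and "cost A C (g(k := i)) = cost A (C - {k}) g + A i k"
proof -
  have fib: "{x\<in>C. (g(k := i)) x = i'} =
    (if i' = i then insert k {x\<in>C - {k}. g x = i'} else {x\<in>C - {k}. g x = i'})" for i'
    using assms(2) by auto
  have "finite {x\<in>C - {k}. g x = i'}" for i' using assms(1) by auto
  then show "assigns R C (m(i := Suc (m i))) (g(k := i))"
    using assms fib unfolding assigns_def by auto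
  show "cost A C (g(k := i)) = cost A (C - {k}) g + A i k"
    unfolding cost_def using assms(1,2) by (simp add: sum.remove cong: sum.cong_simp)
qed

lemma assigns_remove:
  assumes "finite C" "k \<in> C" "i \<in> R" "h k = i" "assigns R C (m(i := Suc (m i))) h"
  shows "assigns R (C - {k}) m h"
    and "cost A C h = cost A (C - {k}) h + A i k"
proof -
  have fib: "{x\<in>C - {k}. h x = i'} =
    (if i' = i then {x\<in>C. h x = i'} - {k} else {x\<in>C. h x = i'})" for i'
    using assms(4) by auto
  have "card {x\<in>C - {k}. h x = i'} = m i'" if "i' \<in> R" for i'
  proof -
    have "card {x\<in>C. h x = i'} = (m(i := Suc (m i))) i'" using assms(5) that unfolding assigns_def by auto
    then show ?thesis using fib assms(1,2,4) by (auto simp: card_Diff_singleton_if)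
  qed
  then show "assigns R (C - {k}) m h" using assms(5) unfolding assigns_def by auto
  show "cost A C h = cost A (C - {k}) h + A i k"
    unfolding cost_def using assms(1,2,4) by (simp add: sum.remove)
qed

section \<open>Exchanging two assignments\<close>

lemma card_fibre_split:
  assumes "finite D" "S \<subseteq> D"
  shows "card {c\<in>D. f c = i} = card {c\<in>S. f c = i} + card {c\<in>D - S. f c = i}"
proof -
  have "{c\<in>D. f c = i} = {c\<in>S. f c = i} \<union> {c\<in>D - S. f c = i}" using assms(2) by auto
  then show ?thesis
    using assms by (simp add: card_Un_disjoint disjoint_iff finite_subset)
qed

lemma assigns_switch:
  assumes "finite D" "S \<subseteq> D" "assigns R D m f" "h ` S \<subseteq> R"
    and "\<And>i. i \<in> R \<Longrightarrow> card {c\<in>S. f c = i} = card {c\<in>S. h c = i}"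
  shows "assigns R D m (\<lambda>c. if c \<in> S then h c else f c)" (is "assigns R D m ?g")
  unfolding assigns_def
proof (intro conjI ballI)
  show "?g ` D \<subseteq> R" using assms(3,4) unfolding assigns_def by auto
  fix i assume i: "i \<in> R"
  have "{c\<in>S. ?g c = i} = {c\<in>S. h c = i}" "{c\<in>D - S. ?g c = i} = {c\<in>D - S. f c = i}" by auto
  then have "card {c\<in>D. ?g c = i} = card {c\<in>D. f c = i}"
    unfolding card_fibre_split[OF assms(1,2), of ?g] card_fibre_split[OF assms(1,2), of f]
    using assms(5)[OF i] by simp
  then show "card {c\<in>D. ?g c = i} = m i" using assms(3) i unfolding assigns_def by simp
qed

text \<open>
  A smallest nonempty subset that \<open>g\<close> maps into itself is mapped onto itself, since its
  image is again such a subset. It plays the role of a cycle of the functional graph of \<open>g\<close>.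
\<close>

lemma periodic_points:
  assumes "finite T" "T \<noteq> {}" "g ` T \<subseteq> T"
  obtains Z where "Z \<subseteq> T" "Z \<noteq> {}" "bij_betw g Z Z"
proof -
  define inv where "inv Z \<longleftrightarrow> Z \<noteq> {} \<and> Z \<subseteq> T \<and> g ` Z \<subseteq> Z" for Z
  have "inv T" using assms unfolding inv_def by simp
  from ex_has_least_nat[of inv, OF this, of card]
  obtain Z where Z: "inv Z" and Zmin: "\<And>Y. inv Y \<Longrightarrow> card Z \<le> card Y" by blast
  have sub: "Z \<noteq> {}" "Z \<subseteq> T" "g ` Z \<subseteq> Z" using Z unfolding inv_def by simp_all
  have finZ: "finite Z" using finite_subset[OF sub(2) assms(1)] .
  have "inv (g ` Z)" using sub unfolding inv_def by blast
  then have "g ` Z = Z" using card_seteq[OF finZ sub(3)] Zmin by simp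
  then have "bij_betw g Z Z" using finZ by (simp add: bij_betw_def finite_surj_inj)
  then show ?thesis using that sub by blast
qed

text \<open>
  Read each column \<open>c \<noteq> j\<close> as an arc from row \<open>f c\<close> to row \<open>h c\<close>; a set of columns
  on which \<open>f\<close> and \<open>h\<close> can be interchanged is one whose arcs form a circulation. Such a set
  containing \<open>k\<close> is found by walking greedily from \<open>i\<close>, with \<open>k\<close> as the first arc and
  no arc used twice. A row \<open>x \<noteq> i\<close> is the head of at most \<open>m x\<close> arcs and the tail
  of exactly \<open>m x\<close>, so a walk that has just entered \<open>x\<close> can leave it again; a longest
  walk can only end at \<open>i\<close>.
\<close>

lemma balanced_exchange_set:
  assumes "finite C" "j \<in> C" "k \<in> C - {j}" "i \<in> R" "f k = i"
    and f: "assigns R (C - {j}) m f" and h: "assigns R C (m(i := Suc (m i))) h"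
  obtains S where "k \<in> S" "S \<subseteq> C - {j}"
    "\<And>r. r \<in> R \<Longrightarrow> card {c\<in>S. f c = r} = card {c\<in>S. h c = r}"
proof -
  \<comment> \<open>The arc set of a trail from \<open>i\<close> to \<open>x\<close> is recorded only through its degree balance.\<close>
  define trail where "trail S x \<longleftrightarrow> k \<in> S \<and> S \<subseteq> C - {j} \<and> x \<in> R \<and>
    (\<forall>r\<in>R. card {c\<in>S. f c = r} + of_bool (r = x) = card {c\<in>S. h c = r} + of_bool (r = i))"
    for S x
  have single: "{c. c = d \<and> P c} = (if P d then {d} else {})" for d :: 'a and P by auto
  have "trail {k} (h k)"
    using assms unfolding trail_def assigns_def by (auto simp: single)
  then have ex: "\<exists>S. \<exists>x. trail S x" by blast
  define trails where "trails = {S. \<exists>x. trail S x}"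
  have "trails \<subseteq> Pow C" unfolding trails_def trail_def by auto
  then have "finite trails" using assms(1) by (simp add: finite_subset)
  moreover have "trails \<noteq> {}" using ex unfolding trails_def by simp
  ultimately have "Max (card ` trails) \<in> card ` trails" by (intro Max_in) auto
  then obtain S where "S \<in> trails" and S_max: "Max (card ` trails) = card S" by blast
  then obtain x where S: "trail S x" unfolding trails_def by blast
  have max: "card S' \<le> card S" if "trail S' x'" for S' x'
  proof -
    have "S' \<in> trails" using that unfolding trails_def by blast
    then show ?thesis unfolding S_max[symmetric] using \<open>finite trails\<close> by simp
  qed
  have SC: "S \<subseteq> C - {j}" "k \<in> S" "x \<in> R" using S unfolding trail_def by auto
  have finS: "finite S" using SC assms(1) finite_subset by blast
  have "x = i"
  proof (rule ccontr)
    assume xi: "x \<noteq> i"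
    have "card {c\<in>S. f c = x} + 1 = card {c\<in>S. h c = x}" using S xi SC(3) unfolding trail_def by auto
    also have "\<dots> \<le> card {c\<in>C. h c = x}" using SC assms(1) by (intro card_mono) auto
    also have "\<dots> = card {c\<in>C - {j}. f c = x}" using f h xi SC(3) unfolding assigns_def by simp
    finally have "card {c\<in>S. f c = x} < card {c\<in>C - {j}. f c = x}" by simp
    then have "\<not> {c\<in>C - {j}. f c = x} \<subseteq> {c\<in>S. f c = x}"
      using card_mono[of "{c\<in>S. f c = x}" "{c\<in>C - {j}. f c = x}"] finS by auto
    then obtain c where c: "c \<in> C - {j}" "f c = x" "c \<notin> S" by auto
    have ins: "card {d \<in> insert c S. P d} = card {d\<in>S. P d} + of_bool (P c)" for P
    proof (cases "P c")
      case True
      then have "{d \<in> insert c S. P d} = insert c {d\<in>S. P d}" by auto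
      then show ?thesis using True c(3) finS by simp
    next
      case False
      then have "{d \<in> insert c S. P d} = {d\<in>S. P d}" by auto
      then show ?thesis using False by simp
    qed
    have "trail (insert c S) (h c)"
      unfolding trail_def
    proof (intro conjI ballI)
      show "h c \<in> R" using c(1) h unfolding assigns_def by auto
      fix r assume "r \<in> R"
      then have "card {c\<in>S. f c = r} + of_bool (r = x) = card {c\<in>S. h c = r} + of_bool (r = i)"
        using S unfolding trail_def by blast
      then show "card {d\<in>insert c S. f d = r} + of_bool (r = h c) =
          card {d\<in>insert c S. h d = r} + of_bool (r = i)"
        using c(2) unfolding ins by (auto simp: eq_commute)
    qed (use SC c(1) in auto)
    from max[OF this] show False using c(3) finS by simp
  qed
  then show ?thesis using that[of S] S SC unfolding trail_def by auto
qed

section \<open>The vector of maximal minors\<close>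

locale corank_one =
  fixes R :: "'r set" and C :: "'c set" and m :: "'r \<Rightarrow> nat" and A :: "'r \<Rightarrow> 'c \<Rightarrow> real"
  assumes finR: "finite R" and finC: "finite C" and cardC: "card C = Suc (sum m R)"
begin

abbreviation p :: "'c \<Rightarrow> real" where "p \<equiv> maximal_minor R C m A"

definition row_min :: "'r \<Rightarrow> real" where "row_min i = Min ((\<lambda>k. p k + A i k) ` C)"

definition tight :: "'r \<Rightarrow> 'c set" where "tight i = {k\<in>C. p k + A i k = row_min i}"

lemma C_nonempty: "C \<noteq> {}"
  using cardC by auto

lemma row_min_le: "k \<in> C \<Longrightarrow> row_min i \<le> p k + A i k"
  unfolding row_min_def using finC by simp

lemma row_min_less: "k \<in> C \<Longrightarrow> k \<notin> tight i \<Longrightarrow> row_min i < p k + A i k"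
  using row_min_le[of k i] unfolding tight_def by auto

lemma minor_le_cost: "assigns R (C - {j}) m f \<Longrightarrow> p j \<le> cost A (C - {j}) f"
  unfolding maximal_minor_def using permanent_le_cost finR finC by blast

lemma minor_attained:
  assumes "j \<in> C"
  obtains f where "assigns R (C - {j}) m f" "cost A (C - {j}) f = p j"
proof -
  have "card (C - {j}) = sum m R" using assms cardC finC by simp
  then show ?thesis
    using optimal_assignment[of R "C - {j}" m A] that finR finC unfolding maximal_minor_def by blast
qed

text \<open>
  An optimal assignment \<open>h\<close> of all columns, for weights raised by one at row \<open>i\<close>, puts
  \<open>m i + 1\<close> columns into row \<open>i\<close>, and each of them attains the minimum of
  \<open>p k + A i k\<close>, which is the cost of \<open>h\<close>.
\<close>

lemma card_tight:
  assumes i: "i \<in> R"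
  shows "card (tight i) \<ge> m i + 1"
proof -
  let ?m = "m(i := Suc (m i))"
  have "sum m R = m i + sum m (R - {i})" "sum ?m R = Suc (m i) + sum m (R - {i})"
    using finR i by (simp_all add: sum.remove)
  then have "card C = sum ?m R" using cardC by simp
  then obtain h where h: "assigns R C ?m h" "cost A C h = tw_permanent R C ?m A"
    using optimal_assignment[OF finR finC, of ?m A] by blast
  have lower: "cost A C h \<le> p k + A i k" if k: "k \<in> C" for k
  proof -
    obtain g where g: "assigns R (C - {k}) m g" "cost A (C - {k}) g = p k"
      using minor_attained[OF k] .
    show ?thesis
      using permanent_le_cost[OF finR finC assigns_extend(1)[OF finC k i g(1)], of A]
        assigns_extend(2)[OF finC k i g(1), of A] g(2) h(2) by simp
  qed
  have upper: "p k + A i k \<le> cost A C h" if k: "k \<in> C" "h k = i" for k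
    using assigns_remove[OF finC k(1) i k(2) h(1)] minor_le_cost[of k h] by simp
  have sub: "{k\<in>C. h k = i} \<subseteq> tight i"
  proof
    fix k assume "k \<in> {k\<in>C. h k = i}"
    then have k: "k \<in> C" "h k = i" by auto
    then have "p k + A i k \<le> p l + A i l" if "l \<in> C" for l
      using upper[OF k] lower[OF that] by simp
    then have "row_min i = p k + A i k"
      unfolding row_min_def using finC k(1) by (intro Min_eqI) auto
    then show "k \<in> tight i" using k unfolding tight_def by simp
  qed
  have "card {k\<in>C. h k = i} = m i + 1" using h(1) i unfolding assigns_def by simp
  then show ?thesis using card_mono[OF _ sub] finC unfolding tight_def by simp
qed

lemma minors_in_kernel: "p \<in> tw_kernel R C m A"
  using card_tight unfolding tw_kernel_def tight_def row_min_def by auto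

text \<open>
  Let \<open>f\<close> put \<open>k\<close> into row \<open>i\<close>, and let \<open>h\<close> consist of an optimal assignment that
  omits a column \<open>l\<close> and of \<open>l\<close> in row \<open>i\<close>. Interchanging \<open>f\<close> and \<open>h\<close>
  on a balanced set that contains \<open>k\<close> preserves their total cost \<open>p j + p l + A i l\<close>.
  Afterwards the first is still an assignment that omits \<open>j\<close>, of cost at least \<open>p j\<close>,
  while the second has \<open>k\<close> in row \<open>i\<close>, so that it costs at least \<open>p k + A i k\<close>. Hence
  \<open>p k + A i k \<le> p l + A i l\<close>.
\<close>

lemma optimal_assignment_tight:
  assumes j: "j \<in> C" and f: "assigns R (C - {j}) m f" "cost A (C - {j}) f = p j"
    and k: "k \<in> C - {j}"
  shows "k \<in> tight (f k)"
proof -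
  define i where "i = f k"
  have i: "i \<in> R" using f(1) k unfolding assigns_def i_def by auto
  have "p k + A i k \<le> p l + A i l" if l: "l \<in> C" for l
  proof -
    obtain g where g: "assigns R (C - {l}) m g" "cost A (C - {l}) g = p l"
      using minor_attained[OF l] .
    define h where "h = g(l := i)"
    have h: "assigns R C (m(i := Suc (m i))) h" "cost A C h = p l + A i l"
      using assigns_extend[OF finC l i g(1)] g(2) unfolding h_def by simp_all
    obtain S where S: "k \<in> S" "S \<subseteq> C - {j}"
      "\<And>r. r \<in> R \<Longrightarrow> card {c\<in>S. f c = r} = card {c\<in>S. h c = r}"
      using balanced_exchange_set[OF finC j k i i_def[symmetric] f(1) h(1)] by blast
    define f' where "f' c = (if c \<in> S then h c else f c)" for c
    define h' where "h' c = (if c \<in> S then f c else h c)" for c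
    have SC: "S \<subseteq> C" "h ` S \<subseteq> R" "f ` S \<subseteq> R"
      using S(2) f(1) h(1) unfolding assigns_def by blast+
    have "assigns R (C - {j}) m f'" unfolding f'_def
      using finC S SC f(1) by (intro assigns_switch) auto
    then have 1: "p j \<le> cost A (C - {j}) f'" by (rule minor_le_cost)
    have "assigns R C (m(i := Suc (m i))) h'" unfolding h'_def
      using finC S SC h(1) by (intro assigns_switch) auto
    moreover have "h' k = i" using S(1) unfolding h'_def i_def by simp
    ultimately have "assigns R (C - {k}) m h'" "cost A C h' = cost A (C - {k}) h' + A i k"
      using assigns_remove[OF finC _ i, of k h' m] k by blast+
    then have 2: "p k + A i k \<le> cost A C h'" using minor_le_cost by simp
    have "cost A C h = cost A (C - {j}) h + A (h j) j" "cost A C h' = cost A (C - {j}) h' + A (h' j) j"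
      unfolding cost_def using finC j by (simp_all add: sum.remove)
    moreover have "h' j = h j" using S(2) unfolding h'_def by auto
    moreover have "cost A (C - {j}) f' + cost A (C - {j}) h' = cost A (C - {j}) f + cost A (C - {j}) h"
      unfolding cost_def sum.distrib[symmetric] by (intro sum.cong) (auto simp: f'_def h'_def)
    ultimately show ?thesis using 1 2 f(2) h(2) by simp
  qed
  then have "row_min i = p k + A i k"
    unfolding row_min_def using finC k by (intro Min_eqI) auto
  then show ?thesis using k unfolding tight_def i_def by auto
qed

text \<open>
  The entries used are \<open>A i c = row_min i - p c\<close>, and their sum does not depend on which
  column goes to which row.
\<close>

lemma cost_of_tight_assignment:
  assumes "assigns R D m f" "D \<subseteq> C" "\<And>c. c \<in> D \<Longrightarrow> c \<in> tight (f c)"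
  shows "cost A D f = (\<Sum>i\<in>R. real (m i) * row_min i) - sum p D"
proof -
  have finD: "finite D" using assms(2) finC finite_subset by blast
  have "cost A D f = (\<Sum>c\<in>D. row_min (f c) - p c)"
    unfolding cost_def using assms(3) by (intro sum.cong) (auto simp: tight_def algebra_simps)
  also have "\<dots> = (\<Sum>c\<in>D. row_min (f c)) - sum p D" by (rule sum_subtractf)
  also have "(\<Sum>c\<in>D. row_min (f c)) = (\<Sum>i\<in>R. \<Sum>c\<in>{c\<in>D. f c = i}. row_min (f c))"
    using assms(1) finD finR by (intro sum.group[symmetric]) (auto simp: assigns_def)
  also have "\<dots> = (\<Sum>i\<in>R. real (m i) * row_min i)"
    using assms(1) by (intro sum.cong) (auto simp: assigns_def)
  finally show ?thesis .
qed

section \<open>Stable sets of columns\<close>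

text \<open>
  These are the sets outside which \<open>p\<close> can be raised by a small constant without leaving the
  kernel: a row without tight columns in \<open>V\<close> has all of them raised together, and any other
  row must retain enough of them in \<open>V\<close>.
\<close>

definition stable :: "'c set \<Rightarrow> bool"
  where "stable V \<longleftrightarrow> V \<subseteq> C \<and> (\<forall>i\<in>R. tight i \<inter> V = {} \<or> card (tight i \<inter> V) \<ge> m i + 1)"

text \<open>
  On the columns where \<open>x - p\<close> is least, a tight column for row \<open>i\<close> minimises both
  summands of \<open>x l + A i l = (x l - p l) + (p l + A i l)\<close>. If there is such a column, the
  minimum in row \<open>i\<close> is attained precisely at the columns of this kind, and the kernel
  condition counts them.
\<close>

lemma kernel_vector_gives_stable_set:
  assumes x: "x \<in> tw_kernel R C m A" and ns: "\<not> trop_scaling_of C x p"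
  obtains V where "stable V" "V \<noteq> {}" "V \<noteq> C"
proof -
  define d where "d k = x k - p k" for k
  define \<delta> where "\<delta> = Min (d ` C)"
  define V where "V = {k\<in>C. d k = \<delta>}"
  have \<delta>: "\<delta> \<le> d k" if "k \<in> C" for k using finC that unfolding \<delta>_def by simp
  have "\<delta> \<in> d ` C" unfolding \<delta>_def using finC C_nonempty by (intro Min_in) auto
  then have "V \<noteq> {}" unfolding V_def by auto
  moreover have "V \<noteq> C"
  proof
    assume "V = C"
    then have "\<forall>k\<in>C. x k = p k + \<delta>" unfolding V_def d_def by force
    then show False using ns unfolding trop_scaling_of_def by blast
  qed
  moreover have "stable V"
    unfolding stable_def
  proof (intro conjI ballI)
    show "V \<subseteq> C" unfolding V_def by auto
    fix i assume i: "i \<in> R"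
    show "tight i \<inter> V = {} \<or> m i + 1 \<le> card (tight i \<inter> V)"
    proof (cases "tight i \<inter> V = {}")
      case False
      then obtain k where k: "k \<in> tight i" "k \<in> V" by auto
      have x_split: "x l + A i l = d l + (p l + A i l)" for l unfolding d_def by simp
      have "Min ((\<lambda>l. x l + A i l) ` C) = \<delta> + row_min i"
      proof (rule Min_eqI)
        show "\<delta> + row_min i \<in> (\<lambda>l. x l + A i l) ` C"
          using k unfolding x_split V_def tight_def by force
        show "\<And>y. y \<in> (\<lambda>l. x l + A i l) ` C \<Longrightarrow> \<delta> + row_min i \<le> y"
          unfolding x_split using \<delta> row_min_le by (auto intro: add_mono)
      qed (use finC in auto)
      moreover have "{l\<in>C. x l + A i l = \<delta> + row_min i} = tight i \<inter> V"
      proof -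
        have "d l + (p l + A i l) = \<delta> + row_min i \<longleftrightarrow> p l + A i l = row_min i \<and> d l = \<delta>"
          if "l \<in> C" for l
          using \<delta>[OF that] row_min_le[OF that, of i] by linarith
        then show ?thesis unfolding x_split V_def tight_def by blast
      qed
      ultimately show ?thesis using x i unfolding tw_kernel_def by auto
    qed simp
  qed
  ultimately show ?thesis using that by blast
qed

text \<open>
  The vector is \<open>p\<close>, raised outside \<open>V\<close> by an amount \<open>\<epsilon>\<close> not exceeding any gap between
  a row minimum and a larger value in the same row.
\<close>

lemma stable_set_gives_kernel_vector:
  assumes V: "stable V" "V \<noteq> {}" "V \<noteq> C"
  obtains x where "x \<in> tw_kernel R C m A" "\<not> trop_scaling_of C x p"
proof -
  define gaps where "gaps = {p k + A i k - row_min i | i k. i \<in> R \<and> k \<in> C \<and> k \<notin> tight i}"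
  \<comment> \<open>The element \<open>1\<close> covers the case that every column is tight for every row.\<close>
  define \<epsilon> where "\<epsilon> = Min (insert 1 gaps)"
  have "gaps \<subseteq> (\<lambda>(i,k). p k + A i k - row_min i) ` (R \<times> C)" unfolding gaps_def by auto
  then have fing: "finite gaps" using finR finC by (meson finite_SigmaI finite_imageI finite_subset)
  have "\<And>y. y \<in> gaps \<Longrightarrow> 0 < y" unfolding gaps_def using row_min_less by fastforce
  then have \<epsilon>0: "\<epsilon> > 0" unfolding \<epsilon>_def using fing by auto
  have \<epsilon>: "row_min i + \<epsilon> \<le> p k + A i k" if "i \<in> R" "k \<in> C" "k \<notin> tight i" for i k
  proof -
    have "\<epsilon> \<le> p k + A i k - row_min i"
      unfolding \<epsilon>_def using fing that by (intro Min_le) (auto simp: gaps_def)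
    then show ?thesis by simp
  qed
  define x where "x k = (if k \<in> V then p k else p k + \<epsilon>)" for k
  have "m i + 1 \<le> card {l\<in>C. x l + A i l = Min ((\<lambda>l. x l + A i l) ` C)}" if i: "i \<in> R" for i
  proof -
    let ?argmin = "{l\<in>C. x l + A i l = Min ((\<lambda>l. x l + A i l) ` C)}"
    show ?thesis
    proof (cases "tight i \<inter> V = {}")
      case True
      have "tight i \<noteq> {}" using card_tight[OF i] by auto
      then have "Min ((\<lambda>l. x l + A i l) ` C) = row_min i + \<epsilon>"
        using True \<epsilon>[OF i] \<epsilon>0 row_min_le[of _ i] finC
        by (intro Min_eqI) (force simp: x_def tight_def)+
      then have "tight i \<subseteq> ?argmin" using True by (auto simp: x_def tight_def)
      then show ?thesis using card_tight[OF i] card_mono[of ?argmin "tight i"] finC by auto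
    next
      case False
      then have "Min ((\<lambda>l. x l + A i l) ` C) = row_min i"
        using \<epsilon>0 row_min_le[of _ i] finC
        by (intro Min_eqI) (force simp: x_def tight_def)+
      then have "tight i \<inter> V \<subseteq> ?argmin" by (auto simp: x_def tight_def)
      then have "card (tight i \<inter> V) \<le> card ?argmin" using finC by (intro card_mono) auto
      moreover have "m i + 1 \<le> card (tight i \<inter> V)" using V(1) i False unfolding stable_def by auto
      ultimately show ?thesis by simp
    qed
  qed
  then have "x \<in> tw_kernel R C m A" unfolding tw_kernel_def by auto
  moreover have "\<not> trop_scaling_of C x p"
  proof
    assume "trop_scaling_of C x p"
    then obtain c where c: "\<forall>k\<in>C. x k = p k + c" unfolding trop_scaling_of_def by blast
    obtain k l where "k \<in> V" "k \<in> C" "l \<in> C" "l \<notin> V" using V unfolding stable_def by blast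
    then have "x k = p k + c" "x l = p l + c" using c by blast+
    moreover have "x k = p k" "x l = p l + \<epsilon>"
      using \<open>k \<in> V\<close> \<open>l \<notin> V\<close> unfolding x_def by simp_all
    ultimately show False using \<epsilon>0 by simp
  qed
  ultimately show ?thesis using that by blast
qed

text \<open>
  An optimal assignment \<open>f\<close> for the minor assigns all of \<open>V\<close> to a set \<open>T\<close> of rows.
  A row \<open>i\<close> in \<open>T\<close> has more than \<open>m i\<close> tight columns in \<open>V\<close>, hence one, \<open>\<kappa> i\<close>,
  that \<open>f\<close> assigns to a different row of \<open>T\<close>. On a set \<open>Z\<close> of rows permuted by
  \<open>i \<mapsto> f (\<kappa> i)\<close>, giving each \<open>i\<close> the column \<open>\<kappa> i\<close> takes one column from every row
  of \<open>Z\<close> and returns one to it, so this is a second optimal assignment.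
\<close>

lemma stable_set_gives_singular_minor:
  assumes V: "stable V" "V \<noteq> {}" and j: "j \<in> C" "j \<notin> V"
  shows "tw_singular R (C - {j}) m A"
proof -
  define D where "D = C - {j}"
  have finD: "finite D" and DC: "D \<subseteq> C" and VD: "V \<subseteq> D" using finC V(1) j unfolding D_def stable_def by auto
  obtain f where f: "assigns R D m f" "cost A D f = p j"
    using minor_attained[OF j(1)] unfolding D_def .
  have ft: "c \<in> tight (f c)" if "c \<in> D" for c
    using optimal_assignment_tight[OF j(1)] f that unfolding D_def by blast
  define T where "T = f ` V"
  have TR: "T \<subseteq> R" using f(1) VD unfolding T_def assigns_def by auto
  have "\<exists>c. c \<in> tight i \<and> c \<in> V \<and> f c \<noteq> i" if "i \<in> T" for i
  proof (rule ccontr)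
    assume "\<not> ?thesis"
    then have "tight i \<inter> V \<subseteq> {c\<in>D. f c = i}" using VD by auto
    then have "card (tight i \<inter> V) \<le> card {c\<in>D. f c = i}" using finD by (intro card_mono) auto
    also have "\<dots> = m i" using f(1) that TR unfolding assigns_def by auto
    finally have "card (tight i \<inter> V) \<le> m i" .
    moreover have "i \<in> R" using that TR by blast
    ultimately have "tight i \<inter> V = {}" using V(1) unfolding stable_def by force
    then show False using that ft VD unfolding T_def by blast
  qed
  then obtain \<kappa> where \<kappa>: "\<And>i. i \<in> T \<Longrightarrow> \<kappa> i \<in> tight i" "\<And>i. i \<in> T \<Longrightarrow> \<kappa> i \<in> V"
      "\<And>i. i \<in> T \<Longrightarrow> f (\<kappa> i) \<noteq> i"
    by metis
  let ?g = "\<lambda>i. f (\<kappa> i)"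
  have "finite T" using TR finR finite_subset by blast
  moreover have "T \<noteq> {}" using V(2) unfolding T_def by simp
  moreover have "?g ` T \<subseteq> T" using \<kappa>(2) unfolding T_def by blast
  ultimately obtain Z where ZT: "Z \<subseteq> T" and Z: "Z \<noteq> {}" and bij: "bij_betw ?g Z Z"
    by (rule periodic_points)
  have inj: "inj_on ?g Z" and gZ: "?g ` Z = Z" using bij unfolding bij_betw_def by auto
  have inj\<kappa>: "inj_on \<kappa> Z"
    using inj inj_on_imageI2[of f \<kappa> Z] by (simp add: comp_def)
  define S where "S = \<kappa> ` Z"
  define h where "h = the_inv_into Z \<kappa>"
  have h\<kappa>: "h (\<kappa> z) = z" if "z \<in> Z" for z using inj\<kappa> that unfolding h_def by (rule the_inv_into_f_f)
  have SD: "S \<subseteq> D" using \<kappa>(2) VD ZT unfolding S_def by auto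
  have himg: "h ` S = Z" and fimg: "f ` S = Z"
    unfolding S_def image_image using h\<kappa> gZ by simp_all
  have hinj: "inj_on h S" and finj: "inj_on f S"
    unfolding S_def using h\<kappa> inj by (auto simp: inj_on_def)
  have one: "card {c\<in>S. u c = i} = of_bool (i \<in> u ` S)" if "inj_on u S" for u :: "'c \<Rightarrow> 'r" and i
  proof (cases "i \<in> u ` S")
    case True
    then obtain c where "c \<in> S" "i = u c" by auto
    then have "{c\<in>S. u c = i} = {c}" using that by (auto simp: inj_on_def)
    then show ?thesis using True by simp
  next
    case False
    then have empty: "{c\<in>S. u c = i} = {}" by auto
    show ?thesis unfolding empty using False by simp
  qed
  let ?f' = "\<lambda>c. if c \<in> S then h c else f c"
  have f': "assigns R D m ?f'"
  proof (rule assigns_switch[OF finD SD f(1)])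
    show "h ` S \<subseteq> R" using himg ZT TR by simp
    show "card {c\<in>S. f c = i} = card {c\<in>S. h c = i}" for i
      unfolding one[OF hinj] one[OF finj] himg fimg ..
  qed
  have "c \<in> tight (?f' c)" if "c \<in> D" for c
    using ft[OF that] h\<kappa> \<kappa>(1) ZT unfolding S_def by auto
  then have "cost A D ?f' = cost A D f"
    using cost_of_tight_assignment[OF f' DC] cost_of_tight_assignment[OF f(1) DC ft] by simp
  moreover obtain z where "z \<in> Z" using Z by blast
  then have "\<kappa> z \<in> D" "f (\<kappa> z) \<noteq> ?f' (\<kappa> z)"
    using h\<kappa> \<kappa>(3) ZT SD unfolding S_def by auto
  then have "\<exists>c\<in>D. f c \<noteq> ?f' c" by blast
  moreover have "p j = tw_permanent R D m A" unfolding maximal_minor_def D_def ..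
  ultimately have "tw_singular R D m A"
    unfolding singular_iff_assignments[OF finR finD] using f f' by auto
  then show ?thesis unfolding D_def .
qed

text \<open>
  Let \<open>f\<close> and \<open>g\<close> be two optimal assignments that omit \<open>j\<close>. Let \<open>V\<close> be the smallest
  set that contains the columns on which they differ and, with any column tight for a row
  \<open>i\<close>, also contains the \<open>m i\<close> columns that \<open>f\<close> assigns to \<open>i\<close>; it omits \<open>j\<close>. It is
  stable once every row with a tight column in \<open>V\<close> has one more tight column in \<open>V\<close>,
  foreign to it in the sense that \<open>f\<close> assigns it elsewhere.
\<close>

lemma singular_minor_gives_stable_set:
  assumes j: "j \<in> C" and sing: "tw_singular R (C - {j}) m A"
  obtains V where "stable V" "V \<noteq> {}" "V \<noteq> C"
proof -
  define D where "D = C - {j}"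
  have finD: "finite D" using finC unfolding D_def by auto
  have pj: "p j = tw_permanent R D m A" unfolding maximal_minor_def D_def ..
  obtain f g c0 where f: "assigns R D m f" "cost A D f = p j"
    and g: "assigns R D m g" "cost A D g = p j" and c0: "c0 \<in> D" "f c0 \<noteq> g c0"
    using sing[folded D_def] unfolding singular_iff_assignments[OF finR finD] pj by auto
  have ft: "c \<in> tight (f c)" and gt: "c \<in> tight (g c)" if "c \<in> D" for c
    using optimal_assignment_tight[OF j f[unfolded D_def]] optimal_assignment_tight[OF j g[unfolded D_def]]
      that unfolding D_def by simp_all
  have fR: "f c \<in> R" if "c \<in> D" for c using f(1) that unfolding assigns_def by auto
  define E where "E = {(k, c). c \<in> D \<and> k \<in> tight (f c)}"
  define V where "V = E\<^sup>* `` {c\<in>D. f c \<noteq> g c}"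
  have VD: "V \<subseteq> D"
  proof
    fix c assume "c \<in> V"
    then obtain c1 where "c1 \<in> D" "(c1, c) \<in> E\<^sup>*" unfolding V_def by auto
    from this(2,1) show "c \<in> D" by (induction rule: rtrancl_induct) (auto simp: E_def)
  qed
  have closed: "c \<in> V" if "k \<in> V" "c \<in> D" "k \<in> tight (f c)" for k c
  proof -
    have "(k, c) \<in> E" using that unfolding E_def by simp
    then show ?thesis using that(1) unfolding V_def by (auto intro: rtrancl_into_rtrancl)
  qed
  \<comment> \<open>A row whose columns entered \<open>V\<close> by the closure rule was reached through a foreign column
    or had one already; a row of a column where \<open>f\<close> and \<open>g\<close> differ gains a column
    under \<open>g\<close> in exchange for the one it loses.\<close>
  have foreign: "\<exists>k'\<in>V. k' \<in> tight (f k) \<and> f k' \<noteq> f k" if kV: "k \<in> V" for k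
  proof -
    obtain c1 where c1: "c1 \<in> D" "f c1 \<noteq> g c1" "(c1, k) \<in> E\<^sup>*" using kV unfolding V_def by blast
    from c1(3) show ?thesis
    proof (induction rule: rtrancl_induct)
      case base
      let ?i = "f c1"
      have "\<not> {c\<in>D. g c = ?i} \<subseteq> {c\<in>D. f c = ?i}"
      proof
        assume sub: "{c\<in>D. g c = ?i} \<subseteq> {c\<in>D. f c = ?i}"
        have "card {c\<in>D. g c = ?i} = card {c\<in>D. f c = ?i}"
          using f(1) g(1) fR[OF c1(1)] unfolding assigns_def by auto
        then have "{c\<in>D. g c = ?i} = {c\<in>D. f c = ?i}" using sub finD by (intro card_subset_eq) auto
        moreover have "c1 \<in> {c\<in>D. f c = ?i}" using c1(1) by simp
        ultimately have "c1 \<in> {c\<in>D. g c = ?i}" by (simp only:)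
        then show False using c1(2) by simp
      qed
      then obtain c where c: "c \<in> D" "g c = ?i" "f c \<noteq> ?i" by auto
      then have "c \<in> V" unfolding V_def by auto
      then show ?case using c gt[OF c(1)] by auto
    next
      case (step k c)
      have k: "k \<in> V" "k \<in> tight (f c)"
        using step.hyps c1 unfolding V_def E_def by auto
      show ?case
      proof (cases "f k = f c")
        case True
        then show ?thesis using step.IH by simp
      next
        case False
        then show ?thesis using k by blast
      qed
    qed
  qed
  have "stable V"
    unfolding stable_def
  proof (intro conjI ballI)
    show "V \<subseteq> C" using VD unfolding D_def by auto
    fix i assume i: "i \<in> R"
    show "tight i \<inter> V = {} \<or> m i + 1 \<le> card (tight i \<inter> V)"
    proof (cases "tight i \<inter> V = {}")
      case False
      then obtain k where k: "k \<in> tight i" "k \<in> V" by auto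
      have "\<exists>k'\<in>V. k' \<in> tight i \<and> f k' \<noteq> i"
        using foreign[OF k(2)] k by (cases "f k = i") auto
      then obtain k' where k': "k' \<in> V" "k' \<in> tight i" "f k' \<noteq> i" by blast
      have "insert k' {c\<in>D. f c = i} \<subseteq> tight i \<inter> V"
        using k' closed[OF k(2)] k(1) ft by auto
      moreover have "card (insert k' {c\<in>D. f c = i}) = m i + 1"
        using k'(3) f(1) i finD unfolding assigns_def by simp
      moreover have "finite (tight i \<inter> V)" using VD finD finite_subset by blast
      ultimately show ?thesis
        using card_mono[of "tight i \<inter> V" "insert k' {c\<in>D. f c = i}"] by simp
    qed simp
  qed
  moreover have "V \<noteq> {}" using c0 unfolding V_def by auto
  moreover have "V \<noteq> C" using VD j unfolding D_def by auto
  ultimately show ?thesis using that by blast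
qed

theorem unique_kernel_vector_iff:
  "(\<forall>x\<in>tw_kernel R C m A. trop_scaling_of C x p) \<longleftrightarrow>
    (\<forall>j\<in>C. tw_nonsingular R (C - {j}) m A)"
proof
  assume uniq: "\<forall>x\<in>tw_kernel R C m A. trop_scaling_of C x p"
  show "\<forall>j\<in>C. tw_nonsingular R (C - {j}) m A"
  proof (intro ballI notI)
    fix j assume "j \<in> C" "tw_singular R (C - {j}) m A"
    then obtain V where "stable V" "V \<noteq> {}" "V \<noteq> C"
      using singular_minor_gives_stable_set by blast
    then obtain x where "x \<in> tw_kernel R C m A" "\<not> trop_scaling_of C x p"
      using stable_set_gives_kernel_vector by blast
    then show False using uniq by blast
  qed
next
  assume nons: "\<forall>j\<in>C. tw_nonsingular R (C - {j}) m A"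
  show "\<forall>x\<in>tw_kernel R C m A. trop_scaling_of C x p"
  proof (intro ballI, rule ccontr)
    fix x assume "x \<in> tw_kernel R C m A" "\<not> trop_scaling_of C x p"
    then obtain V where V: "stable V" "V \<noteq> {}" "V \<noteq> C"
      using kernel_vector_gives_stable_set by blast
    then obtain j where "j \<in> C" "j \<notin> V" unfolding stable_def by blast
    then show False using stable_set_gives_singular_minor V nons by blast
  qed
qed

end

theorem theorem4p6:
  fixes M N :: nat and m :: "nat \<Rightarrow> nat" and A :: "nat \<Rightarrow> nat \<Rightarrow> real"
  assumes "N \<ge> 1"
    and "tw_matrix (N - 1) N {1..M} {1..N} m A"
  shows "maximal_minor {1..M} {1..N} m A \<in> tw_kernel {1..M} {1..N} m A
    \<and> ((\<forall>x \<in> tw_kernel {1..M} {1..N} m A.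
            trop_scaling_of {1..N} x (maximal_minor {1..M} {1..N} m A))
        \<longleftrightarrow> (\<forall>j\<in>{1..N}. tw_nonsingular {1..M} ({1..N} - {j}) m A))"
proof -
  interpret corank_one "{1..M}" "{1..N}" m A
    using assms unfolding tw_matrix_def by unfold_locales auto
  show ?thesis using minors_in_kernel unique_kernel_vector_iff by blast
qed

end
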